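(* Let $q\ge2$ and let $\mathbf f\in A_q^+\setminus W_q$ have last symbol $q-1$. Then for every $n\ge1$, the set $A_q^n(\mathbf f)$ listed in $\prec$ order if $q$ is even (resp. in $\triangleleft$ order if $q$ is odd) is a $2$-close $3$-Gray code: any two consecutive words differ in at most $3$ positions, and the leftmost and rightmost differing positions are separated by at most one symbol (i.e. the differing positions lie among three consecutive positions).
   Context: $A_q=\{0,1,\dots,q-1\}$; $A_q^n$ is the set of length-$n$ words over $A_q$, $A_q^+$ the nonempty finite words. For a set $X$ of words, $X(\mathbf f)$ is the set of words of $X$ not containing $\mathbf f$ as a factor (contiguous subword). For distinct words $\mathbf s,\mathbf t$ of equal length, with $k$ the leftmost differing position, $u=\sum_{i<k}s_i$ and $v$ the number of nonzero symbols among $s_1,\dots,s_{k-1}$: $\mathbf s\prec\mathbf t$ iff ($u$ even and $s_k<t_k$) or ($u$ odd and $s_k>t_k$); $\mathbf s\triangleleft\mathbf t$ iff ($u+v$ even and $s_k<t_k$) or ($u+v$ odd and $s_k>t_k$). $W_q=\{(q-2)^\ell(q-1):\ell\ge0\}$, where $x^\ell$ denotes $\ell$ repetitions of the symbol $x$. *)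

theory Defs
  imports "HOL-Library.Sublist"
begin

definition words_of_length :: "nat \<Rightarrow> nat \<Rightarrow> nat list set" where
  "words_of_length q n = {w \<in> lists {0..<q}. length w = n}"

definition nonempty_words :: "nat \<Rightarrow> nat list set" where
  "nonempty_words q = lists {0..<q} - {[]}"

definition avoiding :: "nat list set \<Rightarrow> nat list \<Rightarrow> nat list set" where
  "avoiding X f = {w \<in> X. \<not> sublist f w}"

definition W_set :: "nat \<Rightarrow> nat list set" where
  "W_set q = {replicate l (q - 2) @ [q - 1] | l. True}"

text \<open>
  Positions are counted from \<open>0\<close>, so \<open>take k s\<close> is the common prefix that precedes the leftmost
  differing position \<open>k\<close>. The order is increasing or decreasing at \<open>k\<close> according to the parity of
  \<open>h (take k s)\<close>. Words of different lengths are incomparable.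
\<close>

definition parity_less :: "(nat list \<Rightarrow> nat) \<Rightarrow> nat list \<Rightarrow> nat list \<Rightarrow> bool" where
  "parity_less h s t \<longleftrightarrow> length s = length t \<and>
     (\<exists>k<length s. take k s = take k t \<and>
        (even (h (take k s)) \<and> s ! k < t ! k \<or> odd (h (take k s)) \<and> s ! k > t ! k))"

definition prec :: "nat list \<Rightarrow> nat list \<Rightarrow> bool" where
  "prec = parity_less sum_list"

definition tri :: "nat list \<Rightarrow> nat list \<Rightarrow> bool" where
  "tri = parity_less (\<lambda>p. sum_list p + length (filter (\<lambda>a. a \<noteq> 0) p))"

definition listing :: "('a \<Rightarrow> 'a \<Rightarrow> bool) \<Rightarrow> 'a set \<Rightarrow> 'a list" where
  "listing r X = (THE ws. set ws = X \<and> sorted_wrt r ws)"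

definition diff_positions :: "'a list \<Rightarrow> 'a list \<Rightarrow> nat set" where
  "diff_positions s t = {i. i < length s \<and> s ! i \<noteq> t ! i}"

definition gray_code :: "nat \<Rightarrow> 'a list list \<Rightarrow> bool" where
  "gray_code m ws \<longleftrightarrow>
     (\<forall>i. Suc i < length ws \<longrightarrow> card (diff_positions (ws ! i) (ws ! Suc i)) \<le> m)"

text \<open>
  The leftmost and rightmost differing positions of consecutive words have at most \<open>d - 1\<close>
  symbols strictly between them. The extrema are meaningful only if consecutive words are distinct
  and of equal length, as they are in a listing of a set of words of a fixed length.
\<close>

definition close :: "nat \<Rightarrow> 'a list list \<Rightarrow> bool" where
  "close d ws \<longleftrightarrow>
     (\<forall>i. Suc i < length ws \<longrightarrow>
        (let D = diff_positions (ws ! i) (ws ! Suc i) in Max D \<le> Min D + d))"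

text \<open>
  Both orders are strict linear orders on the words of a fixed length, so that the
  description in \<^const>\<open>listing\<close> denotes an actual list.
\<close>

lemma parity_lessI:
  assumes "length s = length t" "k < length s" "take k s = take k t"
    and "even (h (take k s)) \<and> s ! k < t ! k \<or> odd (h (take k s)) \<and> s ! k > t ! k"
  shows "parity_less h s t"
  unfolding parity_less_def using assms by blast

lemma parity_less_irrefl: "\<not> parity_less h s s"
  by (auto simp: parity_less_def)

lemma parity_less_trans:
  assumes "parity_less h s t" "parity_less h t u"
  shows "parity_less h s u"
proof -
  obtain j where j: "j < length s" "take j s = take j t"
      "even (h (take j s)) \<and> s ! j < t ! j \<or> odd (h (take j s)) \<and> s ! j > t ! j"
    using assms(1) by (auto simp: parity_less_def)
  obtain k where k: "k < length t" "take k t = take k u"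
      "even (h (take k t)) \<and> t ! k < u ! k \<or> odd (h (take k t)) \<and> t ! k > u ! k"
    using assms(2) by (auto simp: parity_less_def)
  have len: "length s = length t" "length t = length u"
    using assms by (auto simp: parity_less_def)
  have tk: "take i s = take i u" if "i \<le> j" "i \<le> k" for i
  proof -
    have "take i s = take i (take j s)" "take i t = take i (take j t)"
      "take i t = take i (take k t)" "take i u = take i (take k u)"
      using that by (simp_all add: min_def)
    with j(2) k(2) show ?thesis by metis
  qed
  consider "j < k" | "k < j" | "j = k" by linarith
  then show ?thesis
  proof cases
    case 1
    then have "t ! j = u ! j" using k(2) by (metis nth_take)
    with 1 j(1,3) len show ?thesis by (intro parity_lessI[of s u j] tk) simp_all
  next
    case 2
    then have "s ! k = t ! k" using j(2) by (metis nth_take)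
    moreover have "take k s = take k t"
      using 2 j(2) by (metis min.absorb1 less_imp_le take_take)
    ultimately show ?thesis using 2 k(1,3) len by (intro parity_lessI[of s u k] tk) simp_all
  next
    case 3
    have "even (h (take k s)) \<and> s ! k < u ! k \<or> odd (h (take k s)) \<and> s ! k > u ! k"
      using j(3) k(3) unfolding 3 j(2)[unfolded 3] by linarith
    with 3 j(1) len show ?thesis by (intro parity_lessI[of s u k] tk) simp_all
  qed
qed

lemma parity_less_total:
  assumes "length s = length t" "s \<noteq> t"
  shows "parity_less h s t \<or> parity_less h t s"
proof -
  define k where "k = (LEAST i. i < length s \<and> s ! i \<noteq> t ! i)"
  have ex: "\<exists>i. i < length s \<and> s ! i \<noteq> t ! i"
    using assms by (auto simp: list_eq_iff_nth_eq)
  then have k: "k < length s" "s ! k \<noteq> t ! k"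
    unfolding k_def using LeastI_ex[OF ex] by auto
  have "s ! i = t ! i" if "i < k" for i
    using not_less_Least[of i "\<lambda>i. i < length s \<and> s ! i \<noteq> t ! i"] that k(1)
    unfolding k_def[symmetric] by auto
  then have "take k s = take k t"
    using assms(1) k(1) by (auto simp: list_eq_iff_nth_eq)
  with k assms(1) show ?thesis
    using parity_lessI[of s t k h] parity_lessI[of t s k h] by (metis linorder_neqE_nat)
qed

lemma finite_words_of_length: "finite (words_of_length q n)"
proof -
  have "words_of_length q n = {w. set w \<subseteq> {0..<q} \<and> length w = n}"
    by (auto simp: words_of_length_def)
  then show ?thesis by (simp add: finite_lists_length_eq)
qed

lemma ex_sorted_wrt:
  assumes "finite X" "transp r" "totalp_on X r"
  shows "\<exists>ws. set ws = X \<and> sorted_wrt r ws"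
  using assms(1,3)
proof (induction X rule: finite_induct)
  case empty
  then show ?case by simp
next
  case (insert x X)
  then obtain ws where ws: "set ws = X" "sorted_wrt r ws"
    by (auto simp: totalp_on_def)
  let ?us = "filter (\<lambda>y. r y x) ws @ x # filter (\<lambda>y. r x y) ws"
  have "set ?us = insert x X"
    using insert.prems insert.hyps(2) ws(1) unfolding totalp_on_def by auto
  moreover have "sorted_wrt r ?us"
    using ws(2) assms(2) by (auto simp: sorted_wrt_append sorted_wrt_filter dest: transpD)
  ultimately show ?case by blast
qed

lemma sorted_wrt_unique:
  assumes "asymp r" "sorted_wrt r us" "sorted_wrt r vs" "set us = set vs"
  shows "us = vs"
  using assms(2-4)
proof (induction us arbitrary: vs)
  case Nil
  then show ?case by simp
next
  case (Cons x us)
  then obtain y ws where vs: "vs = y # ws" by (cases vs) auto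
  have asym: "r a b \<Longrightarrow> \<not> r b a" for a b using assms(1) by (auto dest: asympD)
  have hd: "\<forall>a\<in>set us. r x a" "\<forall>a\<in>set ws. r y a"
    using Cons.prems vs by auto
  have "x = y \<or> x \<in> set ws" "x = y \<or> y \<in> set us"
    using Cons.prems(3) vs by auto
  with hd asym have xy: "x = y" by blast
  have "x \<notin> set us" "y \<notin> set ws"
    using hd asym by blast+
  with Cons.prems(3) vs xy have "set us = set ws" by auto
  with Cons vs xy show ?case by auto
qed

lemma ex1_listing:
  assumes "X \<subseteq> words_of_length q n"
  shows "\<exists>!ws. set ws = X \<and> sorted_wrt (parity_less h) ws"
proof -
  have "finite X" using assms finite_words_of_length by (rule finite_subset)
  moreover have tr: "transp (parity_less h)" by (auto intro!: transpI dest: parity_less_trans)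
  moreover have "totalp_on X (parity_less h)"
  proof (rule totalp_onI)
    fix s t assume "s \<in> X" "t \<in> X" "s \<noteq> t"
    with assms show "parity_less h s t \<or> parity_less h t s"
      by (intro parity_less_total) (auto simp: words_of_length_def)
  qed
  moreover have "asymp (parity_less h)"
    by (rule asympI) (metis parity_less_irrefl parity_less_trans)
  ultimately show ?thesis
    using ex_sorted_wrt[of X "parity_less h"] sorted_wrt_unique[of "parity_less h"] by metis
qed

lemma listing_avoiding:
  assumes "r = prec \<or> r = tri"
  shows "set (listing r (avoiding (words_of_length q n) f)) = avoiding (words_of_length q n) f"
    and "sorted_wrt r (listing r (avoiding (words_of_length q n) f))"
proof -
  have "avoiding (words_of_length q n) f \<subseteq> words_of_length q n"
    by (auto simp: avoiding_def)
  moreover obtain h where "r = parity_less h"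
    using assms unfolding prec_def tri_def by metis
  ultimately have "\<exists>!ws. set ws = avoiding (words_of_length q n) f \<and> sorted_wrt r ws"
    using ex1_listing[of "avoiding (words_of_length q n) f" q n h] by simp
  from theI'[OF this]
  show "set (listing r (avoiding (words_of_length q n) f)) = avoiding (words_of_length q n) f"
    and "sorted_wrt r (listing r (avoiding (words_of_length q n) f))"
    unfolding listing_def by simp_all
qed

end

theory Submission
  imports Defs
begin

text \<open>
  Let \<open>k\<close> be the first difference of two consecutive words \<open>s\<close>, \<open>t\<close>. Then \<open>s\<close> is the
  greatest and \<open>t\<close> the least word of the set with its prefix of length \<open>k + 1\<close>. Appending a symbol
  other than \<open>q - 1\<close> never creates the factor \<open>f\<close>, and with respect to the parity governing the
  order, \<open>0\<close> and \<open>q - 2\<close> preserve while \<open>q - 1\<close> flips. An extremal continuation is therefore a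
  truncation of \<open>0 0 \<dots>\<close>, \<open>(q-1) 0 0 \<dots>\<close> or \<open>(q-2) (q-1) 0 0 \<dots>\<close>: for a second \<open>q - 2\<close>, the
  symbol \<open>q - 1\<close> would have to be forbidden after both \<open>p\<close> and \<open>p (q-2)\<close>, which forces
  \<open>f \<in> W\<^sub>q\<close>. Hence \<open>s\<close> and \<open>t\<close> are both zero beyond position \<open>k + 2\<close>.
\<close>

text \<open>Two occurrences of \<open>g\<close> offset by one position give it period 1. The
  induction strips the common last symbol \<open>a\<close> from \<open>g\<close> and from
  \<open>p\<close>.\<close>

lemma suffix_snoc_replicate:
  assumes "suffix g p" "suffix g (p @ [a])"
  shows "g = replicate (length g) a"
  using assms
proof (induction g arbitrary: p rule: rev_induct)
  case Nil
  then show ?case by simp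
next
  case (snoc b g)
  have b: "b = a" and gp: "suffix g p"
    using snoc.prems(2) by simp_all
  from snoc.prems(1) b obtain p' where "p = p' @ [a]" "suffix g p'"
    by (auto simp: suffix_def)
  with snoc.IH[of p'] gp have "g = replicate (length g) a" by simp
  then show ?case
    using b by (metis length_append_singleton replicate_Suc replicate_append_same)
qed

lemma sublist_snocD:
  assumes "sublist f (xs @ [c])" "\<not> sublist f xs"
  shows "suffix f (xs @ [c])"
proof -
  obtain us vs where uv: "xs @ [c] = us @ f @ vs"
    using assms(1) by (auto simp: sublist_def)
  have "vs = []"
  proof (cases vs rule: rev_cases)
    case (snoc vs' d)
    with uv have "xs = us @ f @ vs'" by simp
    with assms(2) show ?thesis by (auto simp: sublist_def)
  qed
  with uv show ?thesis by (auto simp: suffix_def)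
qed

lemma sublist_snoc_neq_last:
  assumes "f \<noteq> []" "c \<noteq> last f" "sublist f (xs @ [c])"
  shows "sublist f xs"
proof (rule ccontr)
  assume "\<not> sublist f xs"
  with assms(3) have "suffix f (xs @ [c])" by (rule sublist_snocD)
  with assms(1,2) show False by (metis last_appendR last_snoc suffix_def)
qed

lemma sublist_append_replicate_neq_last:
  assumes "f \<noteq> []" "c \<noteq> last f" "sublist f (xs @ replicate m c)"
  shows "sublist f xs"
  using assms(3)
proof (induction m)
  case (Suc m)
  then show ?case
    using sublist_snoc_neq_last[OF assms(1,2), of "xs @ replicate m c"]
    by (simp add: replicate_append_same[symmetric])
qed simp

text \<open>With \<open>f = g @ [q - 1]\<close>, the word \<open>g\<close> ends both
  \<open>p\<close> and \<open>p @ [q - 2]\<close>, so it is constant.\<close>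

lemma W_set_of_two_suffixes:
  assumes "f \<noteq> []" "last f = q - 1"
    and "suffix f (p @ [q - 1])" "suffix f (p @ [q - 2, q - 1])"
  shows "f \<in> W_set q"
proof -
  define g where "g = butlast f"
  have f: "f = g @ [q - 1]"
    using assms(1,2) unfolding g_def by (metis append_butlast_last_id)
  have "suffix g p" using assms(3) f by simp
  moreover have "suffix g (p @ [q - 2])"
    using assms(4) f snoc_suffix_snoc[of g "q - 1" "p @ [q - 2]" "q - 1"] by simp
  ultimately have "g = replicate (length g) (q - 2)" by (rule suffix_snoc_replicate)
  with f show ?thesis unfolding W_set_def by blast
qed

lemma parity_less_SucD:
  assumes "parity_less (Suc \<circ> h) s t"
  shows "parity_less h t s"
proof -
  obtain k where "k < length s" "take k s = take k t" "length s = length t"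
      "even (Suc (h (take k s))) \<and> s ! k < t ! k \<or> odd (Suc (h (take k s))) \<and> s ! k > t ! k"
    using assms by (auto simp: parity_less_def)
  then show ?thesis by (intro parity_lessI[of t s k]) auto
qed

text \<open>Captures what the two orders have in common: only the parity effect of appending
  \<open>0\<close>, \<open>q - 2\<close> and \<open>q - 1\<close> matters.\<close>

locale parity_weight =
  fixes q :: nat and h :: "nat list \<Rightarrow> nat"
  assumes q_ge_2: "q \<ge> 2"
    and even_snoc_0 [simp]: "even (h (p @ [0])) \<longleftrightarrow> even (h p)"
    and even_snoc_q2 [simp]: "even (h (p @ [q - 2])) \<longleftrightarrow> even (h p)"
    and even_snoc_q1: "even (h (p @ [q - 1])) \<longleftrightarrow> odd (h p)"
begin

text \<open>Replacing \<open>h\<close> by \<open>Suc \<circ> h\<close> reverses the order, so least words need no separate treatment.\<close>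

lemma parity_weight_Suc: "parity_weight q (Suc \<circ> h)"
  using q_ge_2 even_snoc_q1 by unfold_locales simp_all

lemma maximal_continuation_zero:
  assumes f: "f \<noteq> []" "last f = q - 1" "f \<notin> W_set q"
    and w: "w \<in> avoiding (words_of_length q n) f"
    and max: "\<And>u. u \<in> avoiding (words_of_length q n) f \<Longrightarrow> take j u = take j w \<Longrightarrow>
      \<not> parity_less h w u"
    and i: "j + 2 \<le> i" "i < n"
  shows "w ! i = 0"
proof -
  have len: "length w = n" and set_w: "set w \<subseteq> {0..<q}" and av: "\<not> sublist f w"
    using w by (auto simp: avoiding_def words_of_length_def)
  have Suc_m: "take (Suc m) w = take m w @ [w ! m]" if "m < n" for m
    using that len by (simp add: take_Suc_conv_app_nth)
  have av_take: "\<not> sublist f (take m w)" for m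
    using av sublist_order.order_trans sublist_take by blast
  have no_better: "\<not> (even (h (take m w)) \<and> w ! m < c \<or> odd (h (take m w)) \<and> w ! m > c)"
    if m: "j \<le> m" "m < n" and c: "c < q" "\<not> sublist f (take m w @ [c])" for m c
  proof -
    \<comment> \<open>Zero padding is harmless: \<open>f\<close> ends in \<open>q - 1\<close>, which
      is not \<open>0\<close>. So \<open>u\<close> competes with \<open>w\<close>, and position
      \<open>m\<close> decides between them.\<close>
    define u where "u = (take m w @ [c]) @ replicate (n - Suc m) 0"
    have "length u = n" using m len unfolding u_def by simp
    moreover have "set u \<subseteq> {0..<q}"
      using set_w c(1) set_take_subset[of m w] by (auto simp: u_def)
    moreover have "\<not> sublist f u"
      using sublist_append_replicate_neq_last[of f 0 "take m w @ [c]" "n - Suc m"] c(2) f q_ge_2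
      unfolding u_def by linarith
    ultimately have "u \<in> avoiding (words_of_length q n) f"
      by (auto simp: avoiding_def words_of_length_def)
    moreover have "take j u = take j w" using m len unfolding u_def by (simp add: min_def)
    ultimately have "\<not> parity_less h w u" by (rule max)
    moreover have "take m u = take m w" "u ! m = c"
      using m len unfolding u_def by (simp_all add: nth_append)
    ultimately show ?thesis
      using parity_lessI[of w u m h] m len \<open>length u = n\<close> by auto
  qed
  have other: "\<not> sublist f (take m w @ [c])" if "c \<noteq> q - 1" for m c
    using that f sublist_snoc_neq_last[of f c "take m w"] av_take[of m] by argo
  have odd_zero: "w ! m = 0" if "j \<le> m" "m < n" "odd (h (take m w))" for m
    using no_better[OF that(1,2), of 0] other[of 0 m] that(3) q_ge_2 by auto
  \<comment> \<open>Odd weight forces a \<open>0\<close>, and \<open>0\<close> keeps the weight odd,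
    so the zeros continue to the end.\<close>
  have zeros: "w ! m' = 0" if m: "j \<le> m" "odd (h (take m w))" and m': "m \<le> m'" "m' < n" for m m'
  proof -
    have "odd (h (take m' w))"
      using m'
    proof (induction m' rule: dec_induct)
      case base
      then show ?case using m(2) by simp
    next
      case (step l)
      then have "odd (h (take l w))" by simp
      moreover from this have "w ! l = 0" using odd_zero[of l] step m(1) by simp
      ultimately show ?case using Suc_m[of l] step by simp
    qed
    then show ?thesis using odd_zero[of m'] m m' by simp
  qed
  \<comment> \<open>At even weight larger symbols win. \<open>q - 2\<close> is always allowed, and
    \<open>q - 1\<close> is refused only if it completes an occurrence of \<open>f\<close>.\<close>
  have even_large: "w ! m = q - 1 \<or> w ! m = q - 2 \<and> suffix f (take m w @ [q - 1])"
    if m: "j \<le> m" "m < n" "even (h (take m w))" for m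
  proof -
    have "w ! m < q" using set_w len m(2) nth_mem[of m w] by (metis atLeastLessThan_iff subsetD)
    moreover have "\<not> w ! m < q - 2"
      using no_better[OF m(1,2), of "q - 2"] other[of "q - 2" m] m(3) q_ge_2 by auto
    moreover have "suffix f (take m w @ [q - 1])" if "w ! m < q - 1"
    proof (rule sublist_snocD[OF _ av_take])
      show "sublist f (take m w @ [q - 1])"
        using no_better[OF m(1,2), of "q - 1"] m(3) that q_ge_2 by auto
    qed
    moreover have "w ! m = q - 2" if "w ! m < q" "\<not> w ! m < q - 2" "\<not> w ! m = q - 1"
      using that by linarith
    ultimately show ?thesis using q_ge_2 by fastforce
  qed
  have jn: "j < n" "Suc j < n" using i by simp_all
  consider "odd (h (take j w))" | "even (h (take j w))" "w ! j = q - 1"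
    | "even (h (take j w))" "w ! j = q - 2" "suffix f (take j w @ [q - 1])"
    using even_large[OF order_refl jn(1)] by blast
  then show ?thesis
  proof cases
    case 1
    then show ?thesis using zeros[of j i] i by simp
  next
    case 2
    then have "odd (h (take (Suc j) w))" using Suc_m[OF jn(1)] even_snoc_q1 by metis
    then show ?thesis using zeros[of "Suc j" i] i by simp
  next
    case 3
    have tk: "take (Suc j) w = take j w @ [q - 2]" using Suc_m[OF jn(1)] 3 by simp
    then have ev: "even (h (take (Suc j) w))" using 3 by simp
    \<comment> \<open>A second refusal of \<open>q - 1\<close> would put \<open>f\<close> into
      \<open>W_set q\<close>; thus the weight is odd from \<open>j + 2\<close> on at the
      latest.\<close>
    have "\<not> suffix f (take (Suc j) w @ [q - 1])"
      using W_set_of_two_suffixes[OF f(1,2) 3(3)] f(3) tk by auto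
    then have "w ! Suc j = q - 1" using even_large[of "Suc j"] jn ev by auto
    then have "odd (h (take (Suc (Suc j)) w))" using Suc_m[OF jn(2)] ev even_snoc_q1 by metis
    then show ?thesis using zeros[of "Suc (Suc j)" i] i by simp
  qed
qed

lemma diff_positions_of_consecutive:
  assumes f: "f \<noteq> []" "last f = q - 1" "f \<notin> W_set q"
    and s: "s \<in> avoiding (words_of_length q n) f" and t: "t \<in> avoiding (words_of_length q n) f"
    and less: "parity_less h s t"
    and cons: "\<And>u. u \<in> avoiding (words_of_length q n) f \<Longrightarrow>
      \<not> (parity_less h s u \<and> parity_less h u t)"
  obtains k where "k \<in> diff_positions s t" "diff_positions s t \<subseteq> {k..k + 2}"
proof -
  have len: "length s = n" "length t = n"
    using s t by (auto simp: avoiding_def words_of_length_def)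
  obtain k where k: "k < n" "take k s = take k t"
      and dir: "even (h (take k s)) \<and> s ! k < t ! k \<or> odd (h (take k s)) \<and> s ! k > t ! k"
    using less len by (auto simp: parity_less_def)
  have before: "s ! i = t ! i" if "i < k" for i
    using k(2) that by (metis nth_take)
  \<comment> \<open>Position \<open>k\<close> alone decides, so every word sharing the first
    \<open>k + 1\<close> symbols of \<open>s\<close> precedes every word sharing those of
    \<open>t\<close>. As nothing lies between \<open>s\<close> and \<open>t\<close>, they are
    extremal in their classes.\<close>
  have dir': "parity_less h u v"
    if "take (Suc k) u = take (Suc k) s" "take (Suc k) v = take (Suc k) t"
      "length u = n" "length v = n" for u v
  proof (rule parity_lessI[of u v k])
    have "take k u = take k s" "take k v = take k t"
      using that by (metis le_SucI order_refl min.absorb1 take_take)+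
    moreover have "u ! k = s ! k" "v ! k = t ! k" using that by (metis lessI nth_take)+
    ultimately show "take k u = take k v"
      "even (h (take k u)) \<and> u ! k < v ! k \<or> odd (h (take k u)) \<and> u ! k > v ! k"
      using k(2) dir by simp_all
  qed (use that k in simp_all)
  have len_X: "length u = n" if "u \<in> avoiding (words_of_length q n) f" for u
    using that by (auto simp: avoiding_def words_of_length_def)
  have s0: "s ! i = 0" if "Suc k + 2 \<le> i" "i < n" for i
    using f s _ that
  proof (rule maximal_continuation_zero)
    fix u assume "u \<in> avoiding (words_of_length q n) f" "take (Suc k) u = take (Suc k) s"
    then show "\<not> parity_less h s u"
      using cons dir'[of u t] len len_X by blast
  qed
  interpret rev: parity_weight q "Suc \<circ> h" by (rule parity_weight_Suc)
  have t0: "t ! i = 0" if "Suc k + 2 \<le> i" "i < n" for i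
    using f t _ that
  proof (rule rev.maximal_continuation_zero)
    fix u assume "u \<in> avoiding (words_of_length q n) f" "take (Suc k) u = take (Suc k) t"
    then show "\<not> parity_less (Suc \<circ> h) t u"
      using parity_less_SucD[of h t u] cons dir'[of s u] len len_X by blast
  qed
  show ?thesis
  proof
    show "k \<in> diff_positions s t"
      using k dir len by (auto simp: diff_positions_def)
    show "diff_positions s t \<subseteq> {k..k + 2}"
    proof
      fix i assume "i \<in> diff_positions s t"
      then have i: "i < n" "s ! i \<noteq> t ! i" using len by (auto simp: diff_positions_def)
      then have "\<not> i < k" "\<not> Suc k + 2 \<le> i" using before s0 t0 by auto
      then show "i \<in> {k..k + 2}" by simp
    qed
  qed
qed

end

lemma sorted_wrt_consecutive:
  assumes "asymp r" "sorted_wrt r ws" "Suc i < length ws" "u \<in> set ws"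
  shows "\<not> (r (ws ! i) u \<and> r u (ws ! Suc i))"
proof
  assume r: "r (ws ! i) u \<and> r u (ws ! Suc i)"
  obtain m where m: "m < length ws" "u = ws ! m"
    using assms(4) by (auto simp: in_set_conv_nth)
  have asym: "r a b \<Longrightarrow> \<not> r b a" for a b using assms(1) by (auto dest: asympD)
  consider "m < i" | "m = i" | "m = Suc i" | "Suc i < m" by linarith
  then show False
    using r asym m assms(2,3) sorted_wrt_nth_less[of r ws] by cases (metis Suc_lessD)+
qed

theorem theorem6:
  fixes q n :: nat and f :: "nat list"
  assumes "q \<ge> 2"
    and "f \<in> nonempty_words q - W_set q"
    and "last f = q - 1"
    and "n \<ge> 1"
  shows "let ws = listing (if even q then prec else tri) (avoiding (words_of_length q n) f)
         in gray_code 3 ws \<and> close 2 ws"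
proof -
  define X where "X = avoiding (words_of_length q n) f"
  define h where "h = (if even q then sum_list
    else (\<lambda>p. sum_list p + length (filter (\<lambda>a. a \<noteq> 0) p)))"
  define ws where "ws = listing (if even q then prec else tri) X"
  have order: "(if even q then prec else tri) = parity_less h"
    by (simp add: h_def prec_def tri_def)
  have set_ws: "set ws = X" and sorted: "sorted_wrt (parity_less h) ws"
    using listing_avoiding[of "if even q then prec else tri" q n f]
    unfolding ws_def X_def order[symmetric] by simp_all
  have f: "f \<noteq> []" "f \<notin> W_set q"
    using assms(2) by (auto simp: nonempty_words_def)
  \<comment> \<open>For even \<open>q\<close> the sum already has the right parities. For odd
    \<open>q\<close>, both \<open>q - 2\<close> and \<open>q - 1\<close> are nonzero, and the count
    of nonzero symbols shifts each contribution by one.\<close>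
  interpret parity_weight q h
    using assms(1) by unfold_locales (auto simp: h_def)
  have asym: "asymp (parity_less h)"
    by (rule asympI) (metis parity_less_irrefl parity_less_trans)
  have *: "card D \<le> 3 \<and> Max D \<le> Min D + 2"
    if i: "Suc i < length ws" and D: "D = diff_positions (ws ! i) (ws ! Suc i)" for i D
  proof -
    have "ws ! i \<in> X" "ws ! Suc i \<in> X" using i set_ws nth_mem Suc_lessD by blast+
    moreover have "parity_less h (ws ! i) (ws ! Suc i)"
      using sorted i by (simp add: sorted_wrt_nth_less)
    ultimately obtain k where k: "k \<in> D" "D \<subseteq> {k..k + 2}"
      using diff_positions_of_consecutive[OF f(1) assms(3) f(2)]
        sorted_wrt_consecutive[OF asym sorted i] set_ws D unfolding X_def by metis
    then have fin: "finite D" using finite_subset by blast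
    have "card D \<le> card {k..k + 2}" using k(2) by (intro card_mono) auto
    moreover have "Max D \<le> k + 2" "k \<le> Min D"
      \<comment> \<open>Membership of \<open>k\<close> makes \<open>D\<close> nonempty, so its
        extrema are elements of \<open>D\<close>.\<close>
      using k Max_in[OF fin] Min_in[OF fin] by (metis atLeastAtMost_iff empty_iff subsetD)+
    ultimately show ?thesis by simp
  qed
  then have "gray_code 3 ws \<and> close 2 ws"
    by (auto simp: gray_code_def close_def Let_def)
  then show ?thesis by (simp add: ws_def X_def)
qed

end
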